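(* Let $f_1,f_2:\mathbb{R}^d\to\mathbb{R}$ be in $\mathcal{C}^2$, $x_0\in\mathbb{R}^d$, $\bar\Delta>0$, and for $i\in\{1,2\}$ let $\{\widetilde f_{i,\Delta}\}_{\Delta\in(0,\bar\Delta]}$ be a class of (twice differentiable) models of $f_i$. Put $F=f_1f_2$ and $\widetilde F_\Delta=\widetilde f_{1,\Delta}\widetilde f_{2,\Delta}$. Suppose that for $i\in\{1,2\}$ the class $\{\widetilde f_{i,\Delta}\}_{(0,\bar\Delta]}$ provides order-$N_i^f$ function accuracy, order-$N_i^g$ gradient accuracy and order-$N_i^h$ Hessian accuracy of $f_i$ near $x_0$, where $N_i^f,N_i^g,N_i^h\ge0$. Then $\{\widetilde F_\Delta\}_{(0,\bar\Delta]}$ provides order-$N_F^{fgh}$ Hessian accuracy of $F$ near $x_0$, where $N_F^{fgh}=\min\{N_1^f,N_2^f,N_1^g,N_2^g,N_1^h,N_2^h\}$.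
   Context: $\|\cdot\|$ is the Euclidean norm for vectors and the induced operator norm for matrices; $B_\Delta(x_0)$ is the closed ball of radius $\Delta$ centered at $x_0$. A class of models of $f:\mathbb{R}^d\to\mathbb{R}$ is a family of functions $\widetilde f_\Delta:\mathbb{R}^d\to\mathbb{R}$ indexed by $\Delta\in(0,\bar\Delta]$; when gradients or Hessians of models appear the models are understood to be differentiable, respectively twice differentiable. For real $N\ge0$, the class provides order-$N$ function (respectively gradient, Hessian) accuracy of $f$ near $x_0$ if there is $\kappa\ge0$ such that for all $\Delta\in(0,\bar\Delta]$ and $x\in B_\Delta(x_0)$ one has $|f(x)-\widetilde f_\Delta(x)|\le\kappa\Delta^N$ (respectively $\|\nabla f(x)-\nabla\widetilde f_\Delta(x)\|\le\kappa\Delta^N$, $\|\nabla^2f(x)-\nabla^2\widetilde f_\Delta(x)\|\le\kappa\Delta^N$). *)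

theory Defs
  imports "HOL-Analysis.Analysis"
begin

text \<open>
  The library has the relation \<^term>\<open>GDERIV f x :> D\<close> but no function returning the gradient.
  The value is unspecified where \<open>f\<close> is not differentiable.
\<close>
definition gradient :: "('a::real_inner \<Rightarrow> real) \<Rightarrow> 'a \<Rightarrow> 'a" where
  "gradient f x = (THE D. GDERIV f x :> D)"

lemma gradient_eqI:
  assumes "GDERIV f x :> D"
  shows "gradient f x = D"
  unfolding gradient_def
proof (rule the_equality)
  show "GDERIV f x :> D" by fact
  fix E assume "GDERIV f x :> E"
  with assms have "(\<lambda>h. inner h E) = (\<lambda>h. inner h D)"
    unfolding gderiv_def by (blast intro: has_derivative_unique)
  then show "E = D"
    by (metis vector_eq_ldot)
qed

lemma GDERIV_gradient:
  fixes f :: "'a::euclidean_space \<Rightarrow> real"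
  assumes "f differentiable (at x)"
  shows "GDERIV f x :> gradient f x"
proof -
  obtain f' where f': "(f has_derivative f') (at x)"
    using assms by (auto simp: differentiable_def)
  then have lin: "linear f'"
    by (rule has_derivative_linear)
  have "f' = (\<lambda>h. inner h (adjoint f' 1))"
    by (rule ext) (simp add: adjoint_works[OF lin])
  with f' have "GDERIV f x :> adjoint f' 1"
    unfolding gderiv_def by simp
  then show ?thesis
    using gradient_eqI by metis
qed

definition hessian :: "(real^'n \<Rightarrow> real) \<Rightarrow> real^'n \<Rightarrow> real^'n^'n" where
  "hessian f x = jacobian (gradient f) (at x)"

definition twice_differentiable :: "(real^'n \<Rightarrow> real) \<Rightarrow> bool" where
  "twice_differentiable f \<longleftrightarrow>
     (\<forall>x. f differentiable (at x)) \<and> (\<forall>x. gradient f differentiable (at x))"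

definition C2 :: "(real^'n \<Rightarrow> real) \<Rightarrow> bool" where
  "C2 f \<longleftrightarrow> twice_differentiable f \<and> continuous_on UNIV (hessian f)"

text \<open>
  The norm of the type \<^typ>\<open>real^'n^'m\<close> is the Frobenius norm; the norm induced by the
  Euclidean norm has to be taken as the operator norm of the associated linear map.
\<close>
definition op_norm :: "real^'n^'m \<Rightarrow> real" where
  "op_norm A = onorm (\<lambda>v. A *v v)"

text \<open>
  A class of models is given by \<open>m :: real \<Rightarrow> real^'n \<Rightarrow> real\<close>, where only the members \<open>m \<Delta>\<close> with
  \<open>0 < \<Delta> \<le> \<Delta>bar\<close> are relevant.
\<close>
definition function_accuracy ::
    "real \<Rightarrow> (real \<Rightarrow> real^'n \<Rightarrow> real) \<Rightarrow> real \<Rightarrow> (real^'n \<Rightarrow> real) \<Rightarrow> real^'n \<Rightarrow> bool" where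
  "function_accuracy \<Delta>bar m N f x0 \<longleftrightarrow>
     (\<exists>\<kappa>\<ge>0. \<forall>\<Delta>\<in>{0<..\<Delta>bar}. \<forall>x\<in>cball x0 \<Delta>. \<bar>f x - m \<Delta> x\<bar> \<le> \<kappa> * \<Delta> powr N)"

definition gradient_accuracy ::
    "real \<Rightarrow> (real \<Rightarrow> real^'n \<Rightarrow> real) \<Rightarrow> real \<Rightarrow> (real^'n \<Rightarrow> real) \<Rightarrow> real^'n \<Rightarrow> bool" where
  "gradient_accuracy \<Delta>bar m N f x0 \<longleftrightarrow>
     (\<exists>\<kappa>\<ge>0. \<forall>\<Delta>\<in>{0<..\<Delta>bar}. \<forall>x\<in>cball x0 \<Delta>.
        norm (gradient f x - gradient (m \<Delta>) x) \<le> \<kappa> * \<Delta> powr N)"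

definition hessian_accuracy ::
    "real \<Rightarrow> (real \<Rightarrow> real^'n \<Rightarrow> real) \<Rightarrow> real \<Rightarrow> (real^'n \<Rightarrow> real) \<Rightarrow> real^'n \<Rightarrow> bool" where
  "hessian_accuracy \<Delta>bar m N f x0 \<longleftrightarrow>
     (\<exists>\<kappa>\<ge>0. \<forall>\<Delta>\<in>{0<..\<Delta>bar}. \<forall>x\<in>cball x0 \<Delta>.
        op_norm (hessian f x - hessian (m \<Delta>) x) \<le> \<kappa> * \<Delta> powr N)"

end

theory Submission
  imports Defs
begin

text \<open>
  The product rule gives
  \<open>\<nabla>\<^sup>2(f g) v = f \<nabla>\<^sup>2g v + \<langle>v, \<nabla>f\<rangle> \<nabla>g + g \<nabla>\<^sup>2f v + \<langle>v, \<nabla>g\<rangle> \<nabla>f\<close>.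
  On a fixed ball all factors are bounded by compactness, and every factor is approximated to the
  smallest of the six orders, so each of the four bilinear terms is approximated to that order.
\<close>

section \<open>Operator norm against matrix-vector products and the Frobenius norm\<close>

lemma norm_matrix_vector_le_op_norm: "norm (A *v v) \<le> op_norm A * norm v"
  unfolding op_norm_def by (rule onorm) simp

lemma op_norm_le:
  assumes "\<And>v. norm (A *v v) \<le> b * norm v"
  shows "op_norm A \<le> b"
  unfolding op_norm_def using assms by (rule onorm_le)

text \<open>Every entry is at most the Frobenius norm in absolute value. The crude dimensional
  constant suffices: the bound only transfers boundedness on a compact set from the Frobenius norm
  to \<open>op_norm\<close>.\<close>

lemma op_norm_le_norm:
  fixes A :: "real^'n^'m"
  shows "op_norm A \<le> real CARD('m) * real CARD('n) * norm A"
  unfolding op_norm_def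
proof (rule onorm_le_matrix_component)
  fix i j
  show "\<bar>A $ i $ j\<bar> \<le> norm A"
    by (metis Finite_Cartesian_Product.norm_nth_le component_le_norm_cart order_trans)
qed

section \<open>Product rules for gradients and Hessians\<close>

lemma twice_differentiable_GDERIV:
  "twice_differentiable f \<Longrightarrow> GDERIV f x :> gradient f x"
  unfolding twice_differentiable_def by (blast intro: GDERIV_gradient)

lemma twice_differentiable_has_derivative_gradient:
  assumes "twice_differentiable f"
  shows "(gradient f has_derivative (\<lambda>v. hessian f x *v v)) (at x)"
  using assms unfolding twice_differentiable_def hessian_def by (simp flip: jacobian_works)

lemma gradient_mult:
  assumes "twice_differentiable f" "twice_differentiable g"
  shows "gradient (\<lambda>x. f x * g x) x = f x *\<^sub>R gradient g x + g x *\<^sub>R gradient f x"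
  by (intro gradient_eqI GDERIV_mult twice_differentiable_GDERIV assms)

text \<open>Differentiate \<open>gradient_mult\<close> once more. Applying the Hessian to
  \<open>v\<close> turns the outer products of the two gradients into scaled vectors, so all four
  terms have the form scalar times vector.\<close>

lemma hessian_mult_vector:
  assumes f: "twice_differentiable f" and g: "twice_differentiable g"
  shows "hessian (\<lambda>x. f x * g x) x *v v =
    f x *\<^sub>R (hessian g x *v v) + inner v (gradient f x) *\<^sub>R gradient g x +
    g x *\<^sub>R (hessian f x *v v) + inner v (gradient g x) *\<^sub>R gradient f x"
proof -
  let ?F = "\<lambda>x. f x * g x"
  let ?H = "\<lambda>v. f x *\<^sub>R (hessian g x *v v) + inner v (gradient f x) *\<^sub>R gradient g x +
    (g x *\<^sub>R (hessian f x *v v) + inner v (gradient g x) *\<^sub>R gradient f x)"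
  have "((\<lambda>x. f x *\<^sub>R gradient g x + g x *\<^sub>R gradient f x) has_derivative ?H) (at x)"
    using twice_differentiable_GDERIV[OF f] twice_differentiable_GDERIV[OF g]
    unfolding gderiv_def
    by (intro has_derivative_add has_derivative_scaleR
        twice_differentiable_has_derivative_gradient f g)
  then have H: "(gradient ?F has_derivative ?H) (at x)"
    unfolding gradient_mult[OF f g, abs_def] .
  \<comment> \<open>The derivative \<open>?H\<close> shows that \<open>gradient ?F\<close> is
    differentiable, so its Jacobian matrix also represents its derivative; uniqueness then equates
    the two.\<close>
  then have "(gradient ?F has_derivative (\<lambda>v. hessian ?F x *v v)) (at x)"
    unfolding hessian_def using jacobian_works differentiableI by blast
  then have "(\<lambda>v. hessian ?F x *v v) = ?H"
    using H by (rule has_derivative_unique)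
  then have "hessian ?F x *v v = ?H v"
    by (rule fun_cong)
  then show ?thesis
    by (simp add: algebra_simps)
qed

section \<open>Error propagation through products\<close>

text \<open>
  The bound rests on \<open>a b - a' b' = a (b - b') + (a - a') b - (a - a') (b - b')\<close>. The weights
  \<open>s\<close> and \<open>t\<close> stand for norms of the direction to which a factor has been applied.
\<close>
lemma norm_scaleR_diff_le:
  fixes b b' :: "'a::real_normed_vector"
  assumes "\<bar>a\<bar> \<le> M * s" "norm b \<le> M * t" "\<bar>a - a'\<bar> \<le> e * s" "norm (b - b') \<le> e * t" "e \<le> E"
    and "0 \<le> M" "0 \<le> e" "0 \<le> s" "0 \<le> t"
  shows "norm (a *\<^sub>R b - a' *\<^sub>R b') \<le> (2 * M + E) * e * (s * t)"
proof -
  have "a *\<^sub>R b - a' *\<^sub>R b' = a *\<^sub>R (b - b') + (a - a') *\<^sub>R b - (a - a') *\<^sub>R (b - b')"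
    by (simp add: algebra_simps)
  also have "norm \<dots> \<le> \<bar>a\<bar> * norm (b - b') + \<bar>a - a'\<bar> * norm b + \<bar>a - a'\<bar> * norm (b - b')"
    by (metis (mono_tags) add_mono norm_scaleR norm_triangle_ineq norm_triangle_ineq4
        order_refl order_trans)
  also have "\<dots> \<le> (M * s) * (e * t) + (e * s) * (M * t) + (e * s) * (e * t)"
    using assms by (intro add_mono mult_mono) auto
  also have "\<dots> = (2 * M + e) * (e * (s * t))"
    by (simp add: algebra_simps)
  \<comment> \<open>Only one factor \<open>e\<close> is coarsened to \<open>E\<close>: the quadratic
    part of the error is absorbed into the constant, and the bound stays linear in
    \<open>e\<close>.\<close>
  also have "\<dots> \<le> (2 * M + E) * (e * (s * t))"
    using assms by (intro mult_right_mono) auto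
  finally show ?thesis
    by (simp add: mult.assoc)
qed

text \<open>Pointwise form of the result, with \<open>p\<close> and \<open>q\<close> as models of
  \<open>f\<close> and \<open>g\<close>. The factor 4 counts the bilinear terms of the product rule,
  each of which contributes an error of \<open>(2 * M + E) * e\<close> per unit length of
  \<open>v\<close>.\<close>

lemma op_norm_hessian_mult_diff_le:
  fixes f g p q :: "real^'n \<Rightarrow> real"
  assumes td: "twice_differentiable f" "twice_differentiable g"
      "twice_differentiable p" "twice_differentiable q"
    and f: "\<bar>f x\<bar> \<le> M" "norm (gradient f x) \<le> M" "op_norm (hessian f x) \<le> M"
    and g: "\<bar>g x\<bar> \<le> M" "norm (gradient g x) \<le> M" "op_norm (hessian g x) \<le> M"
    and p: "\<bar>f x - p x\<bar> \<le> e" "norm (gradient f x - gradient p x) \<le> e"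
      "op_norm (hessian f x - hessian p x) \<le> e"
    and q: "\<bar>g x - q x\<bar> \<le> e" "norm (gradient g x - gradient q x) \<le> e"
      "op_norm (hessian g x - hessian q x) \<le> e"
    and "e \<le> E"
  shows "op_norm (hessian (\<lambda>x. f x * g x) x - hessian (\<lambda>x. p x * q x) x) \<le> 4 * (2 * M + E) * e"
proof (rule op_norm_le)
  fix v :: "real^'n"
  have M: "0 \<le> M" and e: "0 \<le> e"
    using f(1) p(1) by linarith+
  have H: "norm (A *v v) \<le> c * norm v" if "op_norm A \<le> c" for A :: "real^'n^'n" and c
    using norm_matrix_vector_le_op_norm[of A v] that
    by (meson mult_right_mono norm_ge_zero order_trans)
  have I: "\<bar>inner v w\<bar> \<le> c * norm v" if "norm w \<le> c" for w and c
    using Cauchy_Schwarz_ineq2[of v w] that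
    by (metis mult.commute mult_right_mono norm_ge_zero order_trans)
  note est = norm_scaleR_diff_le[where M = M and e = e and E = E, OF _ _ _ _ \<open>e \<le> E\<close> M e]
  \<comment> \<open>Function value times Hessian: only the second factor depends on
    \<open>v\<close>, hence the weights \<open>s = 1\<close> and \<open>t = norm v\<close>.\<close>
  have fg: "norm (f x *\<^sub>R (hessian g x *v v) - p x *\<^sub>R (hessian q x *v v))
      \<le> (2 * M + E) * e * (1 * norm v)"
    by (rule est) (use f g p q H[of "hessian g x - hessian q x"] in
        \<open>auto simp: H matrix_vector_mult_diff_rdistrib\<close>)
  have gf: "norm (g x *\<^sub>R (hessian f x *v v) - q x *\<^sub>R (hessian p x *v v))
      \<le> (2 * M + E) * e * (1 * norm v)"
    by (rule est) (use f g p q H[of "hessian f x - hessian p x"] in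
        \<open>auto simp: H matrix_vector_mult_diff_rdistrib\<close>)
  \<comment> \<open>Gradient times gradient: \<open>v\<close> enters through the inner product,
    which Cauchy-Schwarz bounds, hence \<open>s = norm v\<close> and \<open>t = 1\<close>.\<close>
  have dfg: "norm (inner v (gradient f x) *\<^sub>R gradient g x - inner v (gradient p x) *\<^sub>R gradient q x)
      \<le> (2 * M + E) * e * (norm v * 1)"
    by (rule est) (use f g p q in \<open>auto simp: I simp flip: inner_diff_right\<close>)
  have dgf: "norm (inner v (gradient g x) *\<^sub>R gradient f x - inner v (gradient q x) *\<^sub>R gradient p x)
      \<le> (2 * M + E) * e * (norm v * 1)"
    by (rule est) (use f g p q in \<open>auto simp: I simp flip: inner_diff_right\<close>)
  have "(hessian (\<lambda>x. f x * g x) x - hessian (\<lambda>x. p x * q x) x) *v v =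
      ((f x *\<^sub>R (hessian g x *v v) - p x *\<^sub>R (hessian q x *v v)) +
       (inner v (gradient f x) *\<^sub>R gradient g x - inner v (gradient p x) *\<^sub>R gradient q x)) +
      ((g x *\<^sub>R (hessian f x *v v) - q x *\<^sub>R (hessian p x *v v)) +
       (inner v (gradient g x) *\<^sub>R gradient f x - inner v (gradient q x) *\<^sub>R gradient p x))"
    by (simp add: matrix_vector_mult_diff_rdistrib hessian_mult_vector td)
  also have "norm \<dots> \<le> ((2 * M + E) * e * (1 * norm v) + (2 * M + E) * e * (norm v * 1)) +
      ((2 * M + E) * e * (1 * norm v) + (2 * M + E) * e * (norm v * 1))"
    by (intro norm_triangle_mono fg gf dfg dgf)
  finally show "norm ((hessian (\<lambda>x. f x * g x) x - hessian (\<lambda>x. p x * q x) x) *v v)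
      \<le> 4 * (2 * M + E) * e * norm v"
    by (simp add: algebra_simps)
qed

section \<open>Uniform bounds on a closed ball\<close>

lemma C2_bounded_on_cball:
  fixes f :: "real^'n \<Rightarrow> real"
  assumes "C2 f"
  obtains M where "\<And>x. x \<in> cball x0 r \<Longrightarrow>
    \<bar>f x\<bar> \<le> M \<and> norm (gradient f x) \<le> M \<and> op_norm (hessian f x) \<le> M"
proof -
  have td: "twice_differentiable f" and H: "continuous_on UNIV (hessian f)"
    using assms by (auto simp: C2_def)
  have bounded_image: "\<exists>B. \<forall>x\<in>cball x0 r. norm (h x) \<le> B"
    if "continuous_on (cball x0 r) h" for h :: "real^'n \<Rightarrow> 'b::real_normed_vector"
    using compact_imp_bounded[OF compact_continuous_image[OF that compact_cball]]
    by (auto simp: bounded_iff)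
  \<comment> \<open>Continuity of the function and of its gradient follows from their
    differentiability; continuity of the Hessian is the additional condition in
    \<open>C2\<close>.\<close>
  have "continuous_on (cball x0 r) f" "continuous_on (cball x0 r) (gradient f)"
    using td unfolding twice_differentiable_def
    by (auto intro!: differentiable_imp_continuous_on differentiable_at_imp_differentiable_on)
  then obtain B C where B: "\<And>x. x \<in> cball x0 r \<Longrightarrow> \<bar>f x\<bar> \<le> B"
    and C: "\<And>x. x \<in> cball x0 r \<Longrightarrow> norm (gradient f x) \<le> C"
    using bounded_image[of f] bounded_image[of "gradient f"]
    unfolding real_norm_def by blast
  obtain D where D: "\<And>x. x \<in> cball x0 r \<Longrightarrow> norm (hessian f x) \<le> D"
    using bounded_image[OF continuous_on_subset[OF H subset_UNIV]] by blast
  let ?k = "real CARD('n) * real CARD('n)"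
  have "op_norm (hessian f x) \<le> ?k * D" if "x \<in> cball x0 r" for x
    by (rule order_trans[OF op_norm_le_norm]) (simp add: mult_left_mono D[OF that])
  then show thesis
    using B C by (intro that[of "max B (max C (?k * D))"]) (auto simp: le_max_iff_disj)
qed

section \<open>Passing to a common accuracy order\<close>

lemma powr_le_powr_lower_order:
  fixes N :: real
  assumes "0 < \<Delta>" "\<Delta> \<le> \<Delta>bar" "N \<le> N'"
  shows "\<Delta> powr N' \<le> \<Delta>bar powr (N' - N) * \<Delta> powr N"
proof -
  have "\<Delta> powr N' = \<Delta> powr (N' - N) * \<Delta> powr N"
    by (simp flip: powr_add)
  \<comment> \<open>The surplus exponent \<open>N' - N\<close> is nonnegative, so its power is
    largest at the maximal radius; this gives a constant independent of \<Delta>.\<close>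
  also have "\<dots> \<le> \<Delta>bar powr (N' - N) * \<Delta> powr N"
    using assms by (intro mult_right_mono powr_mono2) auto
  finally show ?thesis .
qed

text \<open>The error measure \<open>err\<close> is left abstract so that one argument serves
  function, gradient and Hessian accuracy.\<close>

lemma accuracy_lower_order:
  fixes err :: "real \<Rightarrow> 'a::metric_space \<Rightarrow> real"
  assumes acc: "\<exists>\<kappa>\<ge>0. \<forall>\<Delta>\<in>{0<..\<Delta>bar}. \<forall>x\<in>cball x0 \<Delta>. err \<Delta> x \<le> \<kappa> * \<Delta> powr N'" and "N \<le> N'"
  shows "\<exists>\<kappa>\<ge>0. \<forall>\<Delta>\<in>{0<..\<Delta>bar}. \<forall>x\<in>cball x0 \<Delta>. err \<Delta> x \<le> \<kappa> * \<Delta> powr N"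
proof -
  obtain \<kappa> where "\<kappa> \<ge> 0"
    and \<kappa>: "\<And>\<Delta> x. \<Delta> \<in> {0<..\<Delta>bar} \<Longrightarrow> x \<in> cball x0 \<Delta> \<Longrightarrow> err \<Delta> x \<le> \<kappa> * \<Delta> powr N'"
    using acc by blast
  have "err \<Delta> x \<le> (\<kappa> * \<Delta>bar powr (N' - N)) * \<Delta> powr N"
    if "\<Delta> \<in> {0<..\<Delta>bar}" "x \<in> cball x0 \<Delta>" for \<Delta> x
    using \<kappa>[OF that] powr_le_powr_lower_order[of \<Delta> \<Delta>bar N N'] that \<open>N \<le> N'\<close>
      mult_left_mono[OF _ \<open>\<kappa> \<ge> 0\<close>] by (fastforce simp: mult.assoc)
  then show ?thesis
    using \<open>\<kappa> \<ge> 0\<close> by (intro exI[of _ "\<kappa> * \<Delta>bar powr (N' - N)"]) auto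
qed

lemma accuracy_common_order:
  assumes "function_accuracy \<Delta>bar m Nf f x0" "gradient_accuracy \<Delta>bar m Ng f x0"
      "hessian_accuracy \<Delta>bar m Nh f x0"
    and "N \<le> Nf" "N \<le> Ng" "N \<le> Nh"
  obtains \<kappa> where "\<kappa> \<ge> 0"
    "\<And>\<Delta> x. \<Delta> \<in> {0<..\<Delta>bar} \<Longrightarrow> x \<in> cball x0 \<Delta> \<Longrightarrow>
      \<bar>f x - m \<Delta> x\<bar> \<le> \<kappa> * \<Delta> powr N \<and>
      norm (gradient f x - gradient (m \<Delta>) x) \<le> \<kappa> * \<Delta> powr N \<and>
      op_norm (hessian f x - hessian (m \<Delta>) x) \<le> \<kappa> * \<Delta> powr N"
proof -
  obtain a where a: "a \<ge> 0" "\<And>\<Delta> x. \<Delta> \<in> {0<..\<Delta>bar} \<Longrightarrow> x \<in> cball x0 \<Delta> \<Longrightarrow>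
      \<bar>f x - m \<Delta> x\<bar> \<le> a * \<Delta> powr N"
    using accuracy_lower_order[OF assms(1)[unfolded function_accuracy_def] assms(4)] by blast
  obtain b where b: "b \<ge> 0" "\<And>\<Delta> x. \<Delta> \<in> {0<..\<Delta>bar} \<Longrightarrow> x \<in> cball x0 \<Delta> \<Longrightarrow>
      norm (gradient f x - gradient (m \<Delta>) x) \<le> b * \<Delta> powr N"
    using accuracy_lower_order[OF assms(2)[unfolded gradient_accuracy_def] assms(5)] by blast
  obtain c where c: "c \<ge> 0" "\<And>\<Delta> x. \<Delta> \<in> {0<..\<Delta>bar} \<Longrightarrow> x \<in> cball x0 \<Delta> \<Longrightarrow>
      op_norm (hessian f x - hessian (m \<Delta>) x) \<le> c * \<Delta> powr N"
    using accuracy_lower_order[OF assms(3)[unfolded hessian_accuracy_def] assms(6)] by blast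
  \<comment> \<open>The sum of the three nonnegative constants dominates each of them and serves as
    the common constant.\<close>
  have "a * \<Delta> powr N \<le> (a + b + c) * \<Delta> powr N" "b * \<Delta> powr N \<le> (a + b + c) * \<Delta> powr N"
    "c * \<Delta> powr N \<le> (a + b + c) * \<Delta> powr N" for \<Delta>
    using a(1) b(1) c(1) by (simp_all add: mult_right_mono)
  note le = order_trans[OF _ this(1)] order_trans[OF _ this(2)] order_trans[OF _ this(3)]
  show thesis
    using a(1) b(1) c(1)
    by (intro that[of "a + b + c"] conjI le(1)[OF a(2)] le(2)[OF b(2)] le(3)[OF c(2)]) auto
qed

section \<open>Assembling one constant for the product\<close>

theorem theorem13:
  fixes f1 f2 :: "real^'n \<Rightarrow> real"
    and m1 m2 :: "real \<Rightarrow> real^'n \<Rightarrow> real"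
    and x0 :: "real^'n"
    and \<Delta>bar Nf1 Nf2 Ng1 Ng2 Nh1 Nh2 :: real
  assumes "C2 f1" and "C2 f2"
    and "\<Delta>bar > 0"
    and "\<And>\<Delta>. \<Delta> \<in> {0<..\<Delta>bar} \<Longrightarrow> twice_differentiable (m1 \<Delta>)"
    and "\<And>\<Delta>. \<Delta> \<in> {0<..\<Delta>bar} \<Longrightarrow> twice_differentiable (m2 \<Delta>)"
    and "Nf1 \<ge> 0" and "Nf2 \<ge> 0" and "Ng1 \<ge> 0" and "Ng2 \<ge> 0" and "Nh1 \<ge> 0" and "Nh2 \<ge> 0"
    and "function_accuracy \<Delta>bar m1 Nf1 f1 x0"
    and "gradient_accuracy \<Delta>bar m1 Ng1 f1 x0"
    and "hessian_accuracy \<Delta>bar m1 Nh1 f1 x0"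
    and "function_accuracy \<Delta>bar m2 Nf2 f2 x0"
    and "gradient_accuracy \<Delta>bar m2 Ng2 f2 x0"
    and "hessian_accuracy \<Delta>bar m2 Nh2 f2 x0"
  shows "hessian_accuracy \<Delta>bar (\<lambda>\<Delta> x. m1 \<Delta> x * m2 \<Delta> x)
           (Min {Nf1, Nf2, Ng1, Ng2, Nh1, Nh2}) (\<lambda>x. f1 x * f2 x) x0"
proof -
  define N where "N = Min {Nf1, Nf2, Ng1, Ng2, Nh1, Nh2}"
  have N: "N \<le> Nf1" "N \<le> Nf2" "N \<le> Ng1" "N \<le> Ng2" "N \<le> Nh1" "N \<le> Nh2"
    by (simp_all add: N_def)
  \<comment> \<open>Nonnegativity of the order makes \<Delta> \<open>powr N\<close> increasing in
    \<Delta>, so the errors are bounded uniformly over all radii.\<close>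
  have "N \<ge> 0"
    using assms(6-11) by (simp add: N_def)
  obtain M1 where M1: "\<And>x. x \<in> cball x0 \<Delta>bar \<Longrightarrow>
      \<bar>f1 x\<bar> \<le> M1 \<and> norm (gradient f1 x) \<le> M1 \<and> op_norm (hessian f1 x) \<le> M1"
    by (rule C2_bounded_on_cball[OF \<open>C2 f1\<close>, of x0 \<Delta>bar]) blast
  obtain M2 where M2: "\<And>x. x \<in> cball x0 \<Delta>bar \<Longrightarrow>
      \<bar>f2 x\<bar> \<le> M2 \<and> norm (gradient f2 x) \<le> M2 \<and> op_norm (hessian f2 x) \<le> M2"
    by (rule C2_bounded_on_cball[OF \<open>C2 f2\<close>, of x0 \<Delta>bar]) blast
  obtain \<kappa>1 where \<kappa>1: "\<kappa>1 \<ge> 0"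
    "\<And>\<Delta> x. \<Delta> \<in> {0<..\<Delta>bar} \<Longrightarrow> x \<in> cball x0 \<Delta> \<Longrightarrow>
      \<bar>f1 x - m1 \<Delta> x\<bar> \<le> \<kappa>1 * \<Delta> powr N \<and>
      norm (gradient f1 x - gradient (m1 \<Delta>) x) \<le> \<kappa>1 * \<Delta> powr N \<and>
      op_norm (hessian f1 x - hessian (m1 \<Delta>) x) \<le> \<kappa>1 * \<Delta> powr N"
    by (rule accuracy_common_order[OF assms(12-14) N(1,3,5)]) blast
  obtain \<kappa>2 where \<kappa>2: "\<kappa>2 \<ge> 0"
    "\<And>\<Delta> x. \<Delta> \<in> {0<..\<Delta>bar} \<Longrightarrow> x \<in> cball x0 \<Delta> \<Longrightarrow>
      \<bar>f2 x - m2 \<Delta> x\<bar> \<le> \<kappa>2 * \<Delta> powr N \<and>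
      norm (gradient f2 x - gradient (m2 \<Delta>) x) \<le> \<kappa>2 * \<Delta> powr N \<and>
      op_norm (hessian f2 x - hessian (m2 \<Delta>) x) \<le> \<kappa>2 * \<Delta> powr N"
    by (rule accuracy_common_order[OF assms(15-17) N(2,4,6)]) blast
  define M where "M = max M1 M2"
  define \<kappa> where "\<kappa> = max \<kappa>1 \<kappa>2"
  \<comment> \<open>This is the pointwise bound \<open>4 * (2 * M + E) * e\<close> for
    \<open>e\<close> = \<kappa> * \<Delta> \<open>powr N\<close> and \<open>E\<close> = \<kappa> *
    \<Delta>bar \<open>powr N\<close>, with the factor \<Delta> \<open>powr N\<close> split
    off.\<close>
  define K where "K = 4 * (2 * M + \<kappa> * \<Delta>bar powr N) * \<kappa>"
  have "M \<ge> 0"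
    using M1[of x0] \<open>\<Delta>bar > 0\<close> by (auto simp: M_def le_max_iff_disj intro: order_trans[OF abs_ge_zero])
  have "\<kappa> \<ge> 0"
    using \<kappa>1(1) by (simp add: \<kappa>_def)
  have "K \<ge> 0"
    using \<open>M \<ge> 0\<close> \<open>\<kappa> \<ge> 0\<close> by (simp add: K_def)
  have "op_norm (hessian (\<lambda>x. f1 x * f2 x) x - hessian (\<lambda>x. m1 \<Delta> x * m2 \<Delta> x) x) \<le> K * \<Delta> powr N"
    if \<Delta>: "\<Delta> \<in> {0<..\<Delta>bar}" and x: "x \<in> cball x0 \<Delta>" for \<Delta> x
  proof -
    \<comment> \<open>The balls are nested, so the bounds \<open>M1\<close> and \<open>M2\<close> on
      the largest ball hold at every smaller radius.\<close>
    have x': "x \<in> cball x0 \<Delta>bar"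
      using \<Delta> x by auto
    have "\<kappa>1 * \<Delta> powr N \<le> \<kappa> * \<Delta> powr N" "\<kappa>2 * \<Delta> powr N \<le> \<kappa> * \<Delta> powr N"
      by (simp_all add: \<kappa>_def mult_right_mono)
    note le = order_trans[OF _ this(1)] order_trans[OF _ this(2)]
    have "\<kappa> * \<Delta> powr N \<le> \<kappa> * \<Delta>bar powr N"
      using \<Delta> \<open>N \<ge> 0\<close> \<open>\<kappa> \<ge> 0\<close> by (intro mult_left_mono powr_mono2) auto
    then have "op_norm (hessian (\<lambda>x. f1 x * f2 x) x - hessian (\<lambda>x. m1 \<Delta> x * m2 \<Delta> x) x)
        \<le> 4 * (2 * M + \<kappa> * \<Delta>bar powr N) * (\<kappa> * \<Delta> powr N)"
      using assms(1,2,4,5) \<Delta> M1[OF x'] M2[OF x'] \<kappa>1(2)[OF \<Delta> x] \<kappa>2(2)[OF \<Delta> x]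
      by (intro op_norm_hessian_mult_diff_le) (auto simp: C2_def M_def le_max_iff_disj intro: le)
    then show ?thesis
      by (simp add: K_def mult.assoc)
  qed
  then show ?thesis
    unfolding hessian_accuracy_def N_def using \<open>K \<ge> 0\<close> by blast
qed

end
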